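(* Let $n \ge 1$ and $q < n$ be positive integers, let $A \in \mathbb{R}^{n\times n}$ and $C \in \mathbb{R}^{q \times n}$, and consider the differential-algebraic equation (DAE) $$\dot z(t) = A\, z(t), \qquad 0 = C\, z(t), \qquad z(t) \in \mathbb{R}^n, \quad t \ge 0.$$ Define $$\mathcal{O}_n := \begin{bmatrix} C \\ CA \\ \vdots \\ CA^{n-1} \end{bmatrix} \in \mathbb{R}^{qn \times n}.$$ Then: (1) The DAE has a solution with initial condition $z(0) = z_0 \in \mathbb{R}^n$ if and only if $z_0$ belongs to the null space $\mathsf{Nu}(\mathcal{O}_n)$. (2) When $z_0 \in \mathsf{Nu}(\mathcal{O}_n)$, the solution satisfies $z(t) \in \mathsf{Nu}(\mathcal{O}_n)$ for all $t \ge 0$. (3) $\mathsf{Nu}(\mathcal{O}_n)$ is the largest $A$-invariant subspace contained in $\mathsf{Nu}(C)$; that is, it is $A$-invariant, it is contained in $\mathsf{Nu}(C)$, and it contains every $A$-invariant subspace of $\mathbb{R}^n$ that is contained in $\mathsf{Nu}(C)$.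
   Context: $\mathsf{Nu}(\cdot)$ denotes the null space (kernel) of a matrix. A subspace $V \subseteq \mathbb{R}^n$ is $A$-invariant if $AV \subseteq V$. A solution of the DAE with initial condition $z_0$ is a differentiable function $z:[0,\infty) \to \mathbb{R}^n$ with $z(0) = z_0$ that satisfies both $\dot z(t) = A z(t)$ and $C z(t) = 0$ for all $t \ge 0$. *)

theory Defs
  imports "HOL-Analysis.Analysis"
begin

(* The class power on "real ^ 'n ^ 'n" is componentwise, so "A ^ k" is not the matrix power. *)
primrec matpow :: "real ^ 'n ^ 'n \<Rightarrow> nat \<Rightarrow> real ^ 'n ^ 'n" where
  "matpow A 0 = mat 1"
| "matpow A (Suc k) = A ** matpow A k"

definition null_space :: "real ^ 'n ^ 'm \<Rightarrow> (real ^ 'n) set" where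
  "null_space M = {v. M *v v = 0}"

definition invariant_subspace :: "real ^ 'n ^ 'n \<Rightarrow> (real ^ 'n) set \<Rightarrow> bool" where
  "invariant_subspace A V \<longleftrightarrow> subspace V \<and> (*v) A ` V \<subseteq> V"

(* The index set {0, ..., n - 1}, n = CARD('n), as a type: an arbitrary finite type 'n carries no
   canonical numbering of its elements, which the exponents in the block matrix below require. *)
typedef ('n :: finite) block_index = "{..<CARD('n)}"
  morphisms block_no Block
  by (rule exI[of _ 0]) simp

lemma UNIV_block_index: "(UNIV :: ('n :: finite) block_index set) = Block ` {..<CARD('n)}"
  using type_definition.univ[OF type_definition_block_index] .

instance block_index :: (finite) finite
  by standard (simp add: UNIV_block_index)

lemma card_block_index: "CARD(('n :: finite) block_index) = CARD('n)"
  using type_definition.card[OF type_definition_block_index[where 'n = 'n]] by simp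

(* Row (k, i) is row i of the block C A^k, with k running through 0, ..., n - 1. *)
definition observability_matrix ::
    "real ^ 'n ^ 'n \<Rightarrow> real ^ 'n ^ 'q \<Rightarrow> real ^ 'n ^ ('n block_index \<times> 'q)" where
  "observability_matrix A C = (\<chi> r. (C ** matpow A (block_no (fst r))) $ snd r)"

lemma card_rows_observability_matrix:
  "CARD(('n :: finite) block_index \<times> ('q :: finite)) = CARD('q) * CARD('n)"
  by (simp add: card_block_index)

(* A function on [0, \<infinity>) is represented by a function on the reals whose values at negative
   arguments are irrelevant; the derivative at 0 is one-sided. *)
definition dae_solution ::
    "real ^ 'n ^ 'n \<Rightarrow> real ^ 'n ^ 'q \<Rightarrow> real ^ 'n \<Rightarrow> (real \<Rightarrow> real ^ 'n) \<Rightarrow> bool" where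
  "dae_solution A C z0 z \<longleftrightarrow> z 0 = z0 \<and>
     (\<forall>t\<ge>0. (z has_vector_derivative A *v z t) (at t within {0..}) \<and> C *v z t = 0)"

end

theory Submission
  imports Defs
begin

lemma matpow_mult_vec: "matpow A k *v v = ((*v) A ^^ k) v"
  by (induction k) (simp_all add: matrix_vector_mul_assoc [symmetric])

lemma linear_funpow_matrix: "linear ((*v) (A :: real ^ 'n ^ 'n) ^^ k)"
proof (induction k)
  case 0
  show ?case by (simp add: id_def linear_ident)
next
  case (Suc k)
  then show ?case
    unfolding funpow.simps by (rule linear_compose) (rule matrix_vector_mul_linear)
qed

text \<open>Block \<open>b\<close> of the product with \<open>v\<close> is C A^k v for k =
  \<open>block_no b\<close>, and \<open>block_no\<close> runs through exactly the exponents below n.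
  Iterating the map instead of forming matrix powers reduces later shifts by A to
  \<open>funpow_swap1\<close>.\<close>

lemma null_space_observability_matrix:
  fixes A :: "real ^ 'n ^ 'n" and C :: "real ^ 'n ^ 'q"
  shows "null_space (observability_matrix A C) = {v. \<forall>k<CARD('n). C *v ((*v) A ^^ k) v = 0}"
proof -
  have row: "(observability_matrix A C *v v) $ (b, i) = (C *v ((*v) A ^^ block_no b) v) $ i"
    for v b i
  proof -
    have "(observability_matrix A C *v v) $ (b, i) = ((C ** matpow A (block_no b)) *v v) $ i"
      by (simp add: observability_matrix_def matrix_vector_mult_def)
    then show ?thesis
      by (simp add: matpow_mult_vec flip: matrix_vector_mul_assoc)
  qed
  have "observability_matrix A C *v v = 0 \<longleftrightarrow> (\<forall>b :: 'n block_index. C *v ((*v) A ^^ block_no b) v = 0)" for v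
    by (simp add: vec_eq_iff row)
  also have "(\<forall>b :: 'n block_index. P (block_no b)) \<longleftrightarrow> (\<forall>k<CARD('n). P k)" for P
    by (metis block_no Block_inverse lessThan_iff)
  finally show ?thesis
    by (simp add: null_space_def)
qed

text \<open>
  The kernels of the truncated observability matrices decrease strictly until they stabilise, so
  counting dimensions they stabilise after at most \<open>n\<close> steps; this replaces Cayley--Hamilton.
\<close>
lemma null_space_observability_matrix_all:
  fixes A :: "real ^ 'n ^ 'n" and C :: "real ^ 'n ^ 'q"
  shows "null_space (observability_matrix A C) = {v. \<forall>k. C *v ((*v) A ^^ k) v = 0}"
proof -
  define K where "K m = {v. \<forall>k<m. C *v ((*v) A ^^ k) v = 0}" for m
  have sub: "subspace (K m)" for m
    by (auto simp: K_def subspace_def linear_0 linear_add linear_scale linear_funpow_matrix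
        matrix_vector_right_distrib matrix_vector_mult_scaleR)
  have anti: "K j \<subseteq> K i" if "i \<le> j" for i j
    using that by (auto simp: K_def)
  have "\<exists>m\<le>CARD('n). K (Suc m) = K m"
  proof (rule ccontr)
    assume neg: "\<not> ?thesis"
    \<comment> \<open>Each strict inclusion costs at least one dimension. The n + 1 strict
      inclusions from \<open>K 0\<close> to \<open>K (Suc n)\<close> are one more than the dimension
      n allows.\<close>
    have "m \<le> Suc CARD('n) \<Longrightarrow> dim (K m) + m \<le> CARD('n)" for m
    proof (induction m)
      case 0
      show ?case
        using dim_subset_UNIV [of "K 0"] by simp
    next
      case (Suc m)
      then have "K (Suc m) \<subset> K m"
        using neg anti [of m "Suc m"] by auto
      then have "dim (K (Suc m)) < dim (K m)"
        using sub dim_psubset by (metis span_eq_iff)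
      with Suc show ?case by simp
    qed
    from this [of "Suc CARD('n)"] show False by simp
  qed
  then obtain m where m: "m \<le> CARD('n)" "K (Suc m) = K m"
    by blast
  \<comment> \<open>The condition on \<open>v\<close> at exponent k + 1 is the condition on A v at
    exponent k, so A maps \<open>K (Suc m)\<close> into \<open>K m\<close>; here the two
    coincide.\<close>
  have inv: "A *v v \<in> K m" if "v \<in> K m" for v
  proof -
    have "v \<in> K (Suc m)"
      using that m by simp
    then show ?thesis
      unfolding K_def by (clarsimp simp: funpow_swap1) (metis Suc_mono comp_apply funpow.simps(2) funpow_swap1)
  qed
  have "C *v ((*v) A ^^ k) v = 0" if "v \<in> K CARD('n)" for v k
  proof -
    have "((*v) A ^^ k) v \<in> K m"
      using that anti [OF m(1)] by (induction k) (auto intro: inv)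
    \<comment> \<open>The conclusion is the condition at exponent 0 for the iterate.
      \<open>K (Suc m)\<close> always contains that condition, whereas \<open>K m\<close> is the
      whole space when m = 0.\<close>
    then have "((*v) A ^^ k) v \<in> K (Suc m)"
      using m by simp
    then show ?thesis
      by (auto simp: K_def)
  qed
  then show ?thesis
    by (auto simp: null_space_observability_matrix K_def)
qed

text \<open>Differentiating C A^k z = 0 along a solution yields C A^(k+1) z = 0. The induction keeps
  \<open>t\<close> arbitrary because a derivative needs the identity on the whole half-line.\<close>

lemma dae_solution_derivatives:
  fixes A :: "real ^ 'n ^ 'n" and C :: "real ^ 'n ^ 'q"
  assumes "dae_solution A C z0 z" and "t \<ge> 0"
  shows "C *v ((*v) A ^^ k) (z t) = 0"
  using \<open>t \<ge> 0\<close>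
proof (induction k arbitrary: t)
  case 0
  then show ?case
    using assms by (simp add: dae_solution_def)
next
  case (Suc k)
  let ?L = "\<lambda>v. C *v ((*v) A ^^ k) v"
  have "linear ?L"
    using linear_compose [OF linear_funpow_matrix [of k A] matrix_vector_mul_linear [of C]]
    by (simp add: o_def)
  then have "bounded_linear ?L"
    by (rule linear_conv_bounded_linear [THEN iffD1])
  moreover have "(z has_vector_derivative A *v z t) (at t within {0..})"
    using assms Suc.prems by (simp add: dae_solution_def)
  ultimately have "((\<lambda>s. ?L (z s)) has_vector_derivative ?L (A *v z t)) (at t within {0..})"
    by (rule bounded_linear.has_vector_derivative)
  moreover have "((\<lambda>s. ?L (z s)) has_vector_derivative 0) (at t within {0..})"
    using Suc by (intro has_vector_derivative_transform [OF _ _ has_vector_derivative_const]) auto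
  \<comment> \<open>Derivatives within a set are unique only at its limit points; at t = 0 the
    approach is from the right.\<close>
  moreover have "at t within {0..} \<noteq> bot"
  proof -
    have "t \<in> closure {t<..}"
      by simp
    also have "\<dots> \<subseteq> closure ({0..} - {t})"
      using Suc.prems by (intro closure_mono) auto
    finally show ?thesis
      by (simp add: at_within_eq_bot_iff)
  qed
  ultimately have "?L (A *v z t) = 0"
    by (meson vector_derivative_unique_within)
  then show ?case
    by (simp add: funpow_swap1)
qed

text \<open>This is exp(tA) v, summed directly as a series of vectors.\<close>

definition exp_solution :: "real ^ 'n ^ 'n \<Rightarrow> real ^ 'n \<Rightarrow> real \<Rightarrow> real ^ 'n" where
  "exp_solution A v t = (\<Sum>k. (t ^ k / fact k) *\<^sub>R ((*v) A ^^ k) v)"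

text \<open>If B bounds the operator norm of A, the series is dominated by the exponential series of
  |t| B, scaled by the norm of v.\<close>

lemma summable_exp_solution:
  "summable (\<lambda>k. (t ^ k / fact k) *\<^sub>R ((*v) (A :: real ^ 'n ^ 'n) ^^ k) v)"
proof -
  obtain B where B: "0 < B" "\<And>v. norm (A *v v) \<le> norm v * B"
    using bounded_linear.pos_bounded [OF matrix_vector_mul_bounded_linear] by blast
  have bound: "norm (((*v) A ^^ k) v) \<le> B ^ k * norm v" for k
  proof (induction k)
    case (Suc k)
    show ?case
      using order_trans [OF B(2) mult_right_mono [OF Suc]] B(1) by (simp add: mult_ac)
  qed simp
  show ?thesis
  proof (rule summable_comparison_test')
    show "summable (\<lambda>k. (inverse (fact k) * (\<bar>t\<bar> * B) ^ k) * norm v)"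
      by (intro summable_mult2 summable_exp)
    show "norm ((t ^ k / fact k) *\<^sub>R ((*v) A ^^ k) v)
        \<le> (inverse (fact k) * (\<bar>t\<bar> * B) ^ k) * norm v" for k
      using mult_left_mono [OF bound [of k], of "\<bar>t\<bar> ^ k / fact k"]
      by (simp add: abs_mult power_abs power_mult_distrib divide_inverse mult_ac)
  qed
qed

text \<open>Linear maps in finite dimension are continuous and so pass through the series. The
  instances used are C, a coordinate, and a coordinate of A x.\<close>

lemma sums_linear_exp_solution:
  fixes L :: "real ^ 'n \<Rightarrow> 'a :: euclidean_space"
  assumes "linear L"
  shows "(\<lambda>k. (t ^ k / fact k) *\<^sub>R L (((*v) A ^^ k) v)) sums L (exp_solution A v t)"
  using bounded_linear.sums [OF linear_conv_bounded_linear [THEN iffD1, OF assms]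
      summable_sums [OF summable_exp_solution [of t A v]]]
  by (simp add: exp_solution_def linear_scale [OF assms])

lemma exp_solution_0: "exp_solution A v 0 = v"
proof -
  \<comment> \<open>Since 0 ^ 0 = 1, the term k = 0 survives.\<close>
  have "(\<Sum>k. (0 ^ k / fact k) *\<^sub>R ((*v) A ^^ k) v) = (\<Sum>k\<in>{0}. (0 ^ k / fact k) *\<^sub>R ((*v) A ^^ k) v)"
    by (rule suminf_finite) auto
  then show ?thesis
    by (simp add: exp_solution_def)
qed

text \<open>Each coordinate is a real power series converging everywhere, so it may be
  differentiated term by term.\<close>

lemma exp_solution_has_vector_derivative:
  fixes A :: "real ^ 'n ^ 'n"
  shows "(exp_solution A v has_vector_derivative A *v exp_solution A v t) (at t)"
proof -
  have "((\<lambda>t. exp_solution A v t $ i) has_real_derivative (A *v exp_solution A v t) $ i) (at t)" for i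
  proof -
    define c where "c k = (((*v) A ^^ k) v) $ i / fact k" for k
    have comp: "(\<lambda>k. c k * s ^ k) sums (exp_solution A v s $ i)" for s
      using sums_linear_exp_solution [of "\<lambda>x. x $ i" s A v]
      by (simp add: c_def mult_ac bounded_linear.linear [OF bounded_linear_vec_nth])
    \<comment> \<open>In \<open>diffs c k\<close> = (k + 1) \<open>c (Suc k)\<close> the factor k +
      1 cancels against the factorial, leaving coordinate i of A^(k+1) v over k!, the coefficient of
      the series for A exp(tA) v.\<close>
    have "(\<lambda>k. diffs c k * t ^ k) sums ((A *v exp_solution A v t) $ i)"
      using sums_linear_exp_solution [of "\<lambda>x. (A *v x) $ i" t A v]
        linear_compose [OF matrix_vector_mul_linear [of A] bounded_linear.linear [OF bounded_linear_vec_nth [of i]]]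
      by (simp add: diffs_def c_def o_def divide_simps mult_ac)
    moreover have "((\<lambda>s. \<Sum>k. c k * s ^ k) has_real_derivative (\<Sum>k. diffs c k * t ^ k)) (at t)"
      by (rule termdiffs_strong_converges_everywhere) (use comp in \<open>auto simp: sums_iff\<close>)
    ultimately show ?thesis
      using comp by (simp add: sums_iff)
  qed
  then show ?thesis
    unfolding has_vector_derivative_def
    by (subst has_derivative_componentwise_within)
      (auto simp: Basis_vec_def inner_axis has_field_derivative_def mult_commute_abs)
qed

theorem lemma1:
  fixes A :: "real ^ 'n ^ 'n" and C :: "real ^ 'n ^ 'q"
  assumes "CARD('q) < CARD('n)"
  shows
    "(\<forall>z0. (\<exists>z. dae_solution A C z0 z) \<longleftrightarrow> z0 \<in> null_space (observability_matrix A C)) \<and>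
     (\<forall>z0 \<in> null_space (observability_matrix A C). \<forall>z. dae_solution A C z0 z \<longrightarrow>
        (\<forall>t\<ge>0. z t \<in> null_space (observability_matrix A C))) \<and>
     (invariant_subspace A (null_space (observability_matrix A C)) \<and>
      null_space (observability_matrix A C) \<subseteq> null_space C \<and>
      (\<forall>V. invariant_subspace A V \<and> V \<subseteq> null_space C \<longrightarrow>
         V \<subseteq> null_space (observability_matrix A C)))"
proof -
  define N where "N = null_space (observability_matrix A C)"
  have N: "v \<in> N \<longleftrightarrow> (\<forall>k. C *v ((*v) A ^^ k) v = 0)" for v
    by (simp add: N_def null_space_observability_matrix_all)
  \<comment> \<open>This is part (2); at t = 0 it also gives the necessity in part (1).\<close>
  have stays: "z t \<in> N" if "dae_solution A C z0 z" "t \<ge> 0" for z0 z t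
    using dae_solution_derivatives [OF that] by (simp add: N)
  have "\<exists>z. dae_solution A C z0 z" if "z0 \<in> N" for z0
  proof -
    \<comment> \<open>For z0 in \<open>N\<close>, every term of the series for C exp(tA) z0
      vanishes.\<close>
    have "C *v exp_solution A z0 t = 0" for t
      using sums_unique [OF sums_linear_exp_solution [OF matrix_vector_mul_linear [of C], of t A z0]] that
      by (simp add: N)
    then have "dae_solution A C z0 (exp_solution A z0)"
      by (simp add: dae_solution_def exp_solution_0 exp_solution_has_vector_derivative
          has_vector_derivative_at_within)
    then show ?thesis by blast
  qed
  moreover have "z0 \<in> N" if "dae_solution A C z0 z" for z0 z
    using stays [OF that, of 0] that by (simp add: dae_solution_def)
  moreover have "invariant_subspace A N"
    unfolding invariant_subspace_def
  proof
    show "subspace N"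
      unfolding N_def null_space_def by (rule linear_subspace_kernel) simp
    show "(*v) A ` N \<subseteq> N"
    proof (clarsimp simp: N)
      fix v k
      assume "\<forall>k. C *v ((*v) A ^^ k) v = 0"
      \<comment> \<open>Invariance is a shift of the exponent, possible because \<open>N\<close> is
        described by all exponents and not only those below n.\<close>
      then have "C *v ((*v) A ^^ Suc k) v = 0" ..
      then show "C *v ((*v) A ^^ k) (A *v v) = 0"
        by (simp add: funpow_swap1)
    qed
  qed
  moreover have "N \<subseteq> null_space C"
    by (force simp: N null_space_def dest: spec [where x = 0])
  moreover have "V \<subseteq> N" if V: "invariant_subspace A V" "V \<subseteq> null_space C" for V
  proof
    fix v
    assume "v \<in> V"
    then have "((*v) A ^^ k) v \<in> V" for k
      using V(1) by (induction k) (auto simp: invariant_subspace_def)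
    then show "v \<in> N"
      using V(2) by (auto simp: N null_space_def)
  qed
  ultimately show ?thesis
    unfolding N_def [symmetric] using stays by blast
qed

end
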